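(* Let $n\ge 4$ be an integer, let $\gamma=0$ if $n$ is even and $\gamma=1$ if $n$ is odd, and let $H_n^4$ be any graph in $\mathscr{H}_n^4$. For $t\in\{0,1,\dots,\lfloor n/2\rfloor-1\}$ put $g_t=\lceil 2^{2t+2+\gamma}/3\rceil$. Then for every such $t$ and every integer $h$ with $2^{\lceil n/2\rceil+t}-g_t\le h\le 2^{\lceil n/2\rceil+t}$, $$\lambda_h(H_n^4)=\xi_{2^{\lceil n/2\rceil+t}}(H_n^4)=(\lfloor n/2\rfloor-t)\,2^{\lceil n/2\rceil+t}.$$
   Context: The family $\mathscr{H}_n^4$ ($n\ge 2$) of $n$-dimensional $K_4$-hypercubes is defined recursively: $\mathscr{H}_2^4=\{K_4\}$; for $n\ge 3$, a graph belongs to $\mathscr{H}_n^4$ if and only if (up to isomorphism) it is obtained from two vertex-disjoint graphs $G_0,G_1\in\mathscr{H}_{n-1}^4$ (not necessarily isomorphic) by adding an arbitrary perfect matching between $V(G_0)$ and $V(G_1)$. Each member of $\mathscr{H}_n^4$ is $(n+1)$-regular with $2^n$ vertices. For a graph $G$ and $X\subseteq V(G)$, $\overline{X}=V(G)\setminus X$ and $[X,\overline{X}]$ is the set of edges with exactly one end in $X$. For $1\le m\le\lfloor |V(G)|/2\rfloor$, $\xi_m(G)=\min\{|[X,\overline{X}]| : |X|=m,\ G[X]\text{ and }G[\overline{X}]\text{ both connected}\}$. For a connected graph $G$ and integer $h\ge1$, the $h$-extra edge-connectivity $\lambda_h(G)$ is the minimum size of an edge set $F\subseteq E(G)$ such that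 $G-F$ is disconnected and every component of $G-F$ has at least $h$ vertices. *)

theory Defs
  imports Complex_Main "HOL-Library.Extended_Nat"
begin

record 'a ugraph =
  verts :: "'a set"
  edges :: "'a set set"

definition complete_graph :: "'a set \<Rightarrow> 'a ugraph" where
  "complete_graph V = \<lparr>verts = V, edges = {e. e \<subseteq> V \<and> card e = 2}\<rparr>"

definition induced_subgraph :: "'a ugraph \<Rightarrow> 'a set \<Rightarrow> 'a ugraph" where
  "induced_subgraph G X = \<lparr>verts = X, edges = {e \<in> edges G. e \<subseteq> X}\<rparr>"

definition delete_edges :: "'a ugraph \<Rightarrow> 'a set set \<Rightarrow> 'a ugraph" where
  "delete_edges G F = \<lparr>verts = verts G, edges = edges G - F\<rparr>"

definition adj_rel :: "'a ugraph \<Rightarrow> ('a \<times> 'a) set" where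
  "adj_rel G = {(u, v). {u, v} \<in> edges G}"

(* The null graph does not count as connected. *)
definition connected_graph :: "'a ugraph \<Rightarrow> bool" where
  "connected_graph G \<longleftrightarrow>
     verts G \<noteq> {} \<and> (\<forall>u \<in> verts G. \<forall>v \<in> verts G. (u, v) \<in> (adj_rel G)\<^sup>*)"

(* The vertex sets of the connected components. *)
definition components :: "'a ugraph \<Rightarrow> 'a set set" where
  "components G = {{v \<in> verts G. (u, v) \<in> (adj_rel G)\<^sup>*} | u. u \<in> verts G}"

definition edge_cut :: "'a ugraph \<Rightarrow> 'a set \<Rightarrow> 'a set set" where
  "edge_cut G X = {e \<in> edges G. \<exists>u \<in> X. \<exists>v \<in> verts G - X. e = {u, v}}"

definition perfect_matching_between :: "'a set \<Rightarrow> 'a set \<Rightarrow> 'a set set \<Rightarrow> bool" where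
  "perfect_matching_between A B M \<longleftrightarrow>
     M \<subseteq> {{a, b} | a b. a \<in> A \<and> b \<in> B} \<and> (\<forall>v \<in> A \<union> B. \<exists>!e. e \<in> M \<and> v \<in> e)"

(* Vertices are arbitrary elements of 'a, so the family contains every isomorphic copy
   (with vertices in 'a) of each of its members. *)
inductive K4_hypercube :: "nat \<Rightarrow> 'a ugraph \<Rightarrow> bool" where
  K4: "card V = 4 \<Longrightarrow> K4_hypercube 2 (complete_graph V)"
| join: "\<lbrakk>n \<ge> 3; K4_hypercube (n - 1) G0; K4_hypercube (n - 1) G1;
    verts G0 \<inter> verts G1 = {}; perfect_matching_between (verts G0) (verts G1) M\<rbrakk>
    \<Longrightarrow> K4_hypercube n
          \<lparr>verts = verts G0 \<union> verts G1, edges = edges G0 \<union> edges G1 \<union> M\<rparr>"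

(* The two minima below are infima in enat: the infimum of the empty set is \<infinity>, so a finite
   value is one that is attained. *)

definition xi :: "nat \<Rightarrow> 'a ugraph \<Rightarrow> enat" where
  "xi m G = (INF X \<in> {X. X \<subseteq> verts G \<and> card X = m \<and>
       connected_graph (induced_subgraph G X) \<and>
       connected_graph (induced_subgraph G (verts G - X))}. enat (card (edge_cut G X)))"

definition extra_edge_cut :: "nat \<Rightarrow> 'a ugraph \<Rightarrow> 'a set set \<Rightarrow> bool" where
  "extra_edge_cut h G F \<longleftrightarrow> F \<subseteq> edges G \<and> \<not> connected_graph (delete_edges G F) \<and>
     (\<forall>C \<in> components (delete_edges G F). card C \<ge> h)"

definition extra_edge_connectivity :: "nat \<Rightarrow> 'a ugraph \<Rightarrow> enat" where
  "extra_edge_connectivity h G = (INF F \<in> {F. extra_edge_cut h G F}. enat (card F))"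

end

(*
  Let D_n(m) bound from below the number of edges leaving an m-set in an n-dimensional
  K4-hypercube.  If X meets the two halves in a and b vertices, at least |a - b| matching edges
  leave X, so D_n(a) + D_n(b) + |a - b| >= D_(n+1)(a + b) must hold.  The optimal D is symmetric
  under m -> 2^n - m and satisfies D_(n+1)(m) = D_n(m) + m on the lower half; taking these two
  rules as its definition turns the required inequality into an induction with three cases.
  Sub-hypercubes of dimension c attain the bound (n - c) 2^c.  With d = n - c, the bound
  D_n(m) >= d 2^c for m = 2^c - r amounts to D_c(r) >= d r, which holds up to
  r = ceiling (2^(c-d+2) / 3); for 2^c <= m <= 2^(n-1) it follows by induction on d.
*)

theory Submission
  imports Defs
begin

section \<open>Arithmetic of the bound: reflection, doubling and the join inequality\<close>

section \<open>A Takagi-type recursion\<close>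

text \<open>The first argument is the dimension minus 2, so that the base case is a single \<open>K\<^sub>4\<close>.\<close>

primrec cut_bound :: "nat \<Rightarrow> nat \<Rightarrow> nat" where
  "cut_bound 0 m = m * (4 - m)"
| "cut_bound (Suc k) m = cut_bound k (min m (2 ^ (k + 3) - m)) + min m (2 ^ (k + 3) - m)"

declare cut_bound.simps(2) [simp del]

lemma cut_bound_sym:
  assumes "m \<le> 2 ^ (k + 2)"
  shows "cut_bound k (2 ^ (k + 2) - m) = cut_bound k m"
proof (cases k)
  case 0
  then show ?thesis using assms by simp
next
  case (Suc j)
  have "min (2 ^ (j + 3) - m) (2 ^ (j + 3) - (2 ^ (j + 3) - m)) = min m (2 ^ (j + 3) - m)"
    using assms Suc by (auto simp: min_def eval_nat_numeral)
  then show ?thesis using Suc by (simp add: cut_bound.simps(2) eval_nat_numeral)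
qed

lemma cut_bound_lower_half:
  assumes "m \<le> 2 ^ (k + 2)"
  shows "cut_bound (Suc k) m = cut_bound k m + m"
proof -
  have "min m (2 ^ (k + 3) - m) = m"
    using assms by (simp add: min_def power_add)
  then show ?thesis by (simp add: cut_bound.simps(2))
qed

lemma cut_bound_upper_half:
  assumes "2 ^ (k + 2) \<le> m" "m \<le> 2 ^ (k + 3)"
  shows "cut_bound (Suc k) m = cut_bound k (2 ^ (k + 3) - m) + (2 ^ (k + 3) - m)"
proof -
  have "min m (2 ^ (k + 3) - m) = 2 ^ (k + 3) - m"
    using assms by (auto simp: min_def power_add)
  then show ?thesis by (simp add: cut_bound.simps(2))
qed

text \<open>This is \<open>cut_bound_join\<close> on the lower half: the new summand
  \<open>a + b\<close> less the matching term \<open>a - b\<close> leaves \<open>2 * b\<close>.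
  Reflection and doubling express all three values one dimension lower, where the induction
  hypothesis compares them; the cases differ in how \<open>a\<close> and \<open>a + b\<close> lie
  relative to the half \<open>N\<close>.\<close>

lemma cut_bound_superadditive:
  assumes "b \<le> a" "a + b \<le> 2 ^ (k + 2)"
  shows "cut_bound k (a + b) + 2 * b \<le> cut_bound k a + cut_bound k b"
  using assms
proof (induction k arbitrary: a b)
  case 0
  then have "a = 0 \<or> a = 1 \<or> a = 2 \<or> a = 3 \<or> a = 4" "b = 0 \<or> b = 1 \<or> b = 2"
    by auto
  then show ?case using 0 by auto
next
  case (Suc k)
  define N where "N = (2::nat) ^ (k + 2)"
  have N2: "2 ^ (k + 3) = 2 * N" unfolding N_def by (simp add: power_add)
  have low: "\<And>m. m \<le> N \<Longrightarrow> cut_bound (Suc k) m = cut_bound k m + m"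
    unfolding N_def by (rule cut_bound_lower_half)
  have up: "\<And>m. N \<le> m \<Longrightarrow> m \<le> 2 * N \<Longrightarrow>
      cut_bound (Suc k) m = cut_bound k (2 * N - m) + (2 * N - m)"
    using cut_bound_upper_half N_def N2 by metis
  have sym: "\<And>m. m \<le> N \<Longrightarrow> cut_bound k (N - m) = cut_bound k m"
    unfolding N_def by (rule cut_bound_sym)
  have IH: "\<And>a b. b \<le> a \<Longrightarrow> a + b \<le> N \<Longrightarrow>
      cut_bound k (a + b) + 2 * b \<le> cut_bound k a + cut_bound k b"
    unfolding N_def by (rule Suc.IH)
  have ab: "b \<le> a" "a + b \<le> 2 * N"
    using Suc.prems N2 by (simp_all add: eval_nat_numeral)
  consider "a + b \<le> N" | "N < a + b" "a \<le> N" | "N < a" by linarith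
  then show ?case
  proof cases
    case 1
    then show ?thesis using IH[of b a] low[of a] low[of b] low[of "a + b"] ab by linarith
  next
    case 2
    \<comment> \<open>Both arguments are reflected in \<open>N\<close>: the larger one is now
      \<open>N - b\<close>, and the sum falls below \<open>N\<close>.\<close>
    have "cut_bound k ((N - b) + (N - a)) + 2 * (N - a) \<le> cut_bound k (N - b) + cut_bound k (N - a)"
      using 2 ab by (intro IH) auto
    moreover have "(N - b) + (N - a) = 2 * N - (a + b)" using 2 ab by auto
    ultimately have "cut_bound k (2 * N - (a + b)) + 2 * (N - a) \<le> cut_bound k (N - b) + cut_bound k (N - a)"
      by (simp only:)
    moreover have "cut_bound (Suc k) (a + b) = cut_bound k (2 * N - (a + b)) + (2 * N - (a + b))"
      using 2 ab by (intro up) auto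
    ultimately show ?thesis
      using 2 ab low[of a] low[of b] sym[of a] sym[of b] by linarith
  next
    case 3
    \<comment> \<open>\<open>x\<close> and \<open>x + b\<close> are the reflections of
      \<open>a + b\<close> and \<open>a\<close> in \<open>2 * N\<close>. In these terms the goal
      reads \<open>cut_bound k x \<le> cut_bound k (x + b) + cut_bound k b\<close>, which after
      reflection in \<open>N\<close> is subadditivity for
      \<open>N - x = (N - (x + b)) + b\<close>.\<close>
    define x where "x = 2 * N - (a + b)"
    have x: "2 * N - a = x + b" "x + b < N" using 3 ab by (auto simp: x_def)
    \<comment> \<open>Either summand may be the larger one, hence the two instances of
      \<open>IH\<close>.\<close>
    have "cut_bound k ((N - (x + b)) + b) \<le> cut_bound k (N - (x + b)) + cut_bound k b"
      using IH[of b "N - (x + b)"] IH[of "N - (x + b)" b] x by (cases "b \<le> N - (x + b)")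
        (auto simp: add.commute)
    moreover have "(N - (x + b)) + b = N - x" using x by auto
    ultimately have "cut_bound k x \<le> cut_bound k (x + b) + cut_bound k b"
      using sym[of x] sym[of "x + b"] x by simp
    moreover have "cut_bound (Suc k) a = cut_bound k (x + b) + (x + b)"
      unfolding x(1)[symmetric] using 3 ab by (intro up) auto
    moreover have "cut_bound (Suc k) (a + b) = cut_bound k x + x"
      unfolding x_def using 3 ab by (intro up) auto
    moreover have "cut_bound (Suc k) b = cut_bound k b + b" using x by (intro low) auto
    ultimately show ?thesis by linarith
  qed
qed

text \<open>In natural numbers one of \<open>a - b\<close> and \<open>b - a\<close> vanishes, so
  their sum is the distance of \<open>a\<close> and \<open>b\<close>. If \<open>a + b\<close>
  exceeds half of the joined graph, passing to the complements in both halves leads back to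
  \<open>cut_bound_superadditive\<close>.\<close>

lemma cut_bound_join:
  assumes "a \<le> 2 ^ (k + 2)" "b \<le> 2 ^ (k + 2)"
  shows "cut_bound (Suc k) (a + b) \<le> cut_bound k a + cut_bound k b + (a - b) + (b - a)"
  using assms
proof (induction b a rule: linorder_wlog)
  case (le b a)
  define N where "N = (2::nat) ^ (k + 2)"
  have N2: "2 ^ (k + 3) = 2 * N" unfolding N_def by (simp add: power_add)
  show ?case
  proof (cases "a + b \<le> N")
    case True
    then show ?thesis
      using cut_bound_superadditive[of b a k] cut_bound_lower_half[of "a + b" k] le
      unfolding N_def by linarith
  next
    case False
    have "cut_bound k ((N - b) + (N - a)) + 2 * (N - a) \<le> cut_bound k (N - b) + cut_bound k (N - a)"
      using False le unfolding N_def by (intro cut_bound_superadditive) auto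
    moreover have "(N - b) + (N - a) = 2 * N - (a + b)" using False le N_def by auto
    ultimately have "cut_bound k (2 * N - (a + b)) + 2 * (N - a) \<le> cut_bound k (N - b) + cut_bound k (N - a)"
      by (simp only:)
    moreover have "cut_bound (Suc k) (a + b) = cut_bound k (2 * N - (a + b)) + (2 * N - (a + b))"
      unfolding N2[symmetric] by (rule cut_bound_upper_half) (use False le N2 N_def in auto)
    moreover have "cut_bound k (N - a) = cut_bound k a" "cut_bound k (N - b) = cut_bound k b"
      unfolding N_def by (rule cut_bound_sym, rule le)+
    ultimately show ?thesis using False le unfolding N_def by linarith
  qed
next
  case (sym a b)
  then show ?case by (simp add: add.commute add.left_commute)
qed

section \<open>Linear lower bounds on the recursion\<close>

lemma cut_bound_shift:
  assumes "m \<le> 2 ^ (k + 2)"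
  shows "cut_bound (k + j) m = cut_bound k m + j * m"
proof (induction j)
  case (Suc j)
  have "m \<le> 2 ^ (k + j + 2)"
    by (rule order_trans[OF assms]) (simp add: power_increasing)
  then show ?case using Suc cut_bound_lower_half[of m "k + j"] by simp
qed simp

text \<open>The first hypothesis says, without division, that \<open>r\<close> is at most the
  ceiling of \<open>2 ^ (e + 2) / 3\<close>. This threshold is self-similar: removing
  \<open>2 ^ e\<close> from \<open>2 ^ (e + 2) / 3\<close> leaves \<open>2 ^ e / 3\<close>, the
  threshold for \<open>e - 2\<close>. Hence the strong induction on \<open>e\<close>.\<close>

lemma cut_bound_ge_slope:
  assumes "3 * r \<le> 2 ^ (e + 2) + 2" "e + d = k + 2" "d \<ge> 1"
  shows "d * r \<le> cut_bound k r"
  using assms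
proof (induction e arbitrary: r d k rule: less_induct)
  case (less e)
  \<comment> \<open>\<open>cut_bound\<close> starts in dimension 2, so \<open>e = 0\<close> and
    \<open>e = 1\<close> are settled by explicit values. For \<open>r \<le> 2 ^ e\<close> the
    \<open>d\<close> doublings from dimension \<open>e\<close> to \<open>k + 2\<close> alone
    contribute \<open>d * r\<close>.\<close>
  consider "e = 0" | "e = 1" | "e \<ge> 2" "r \<le> 2 ^ e" | "e \<ge> 2" "2 ^ e < r" by linarith
  then show ?case
  proof cases
    case 1
    then have "r \<le> 2" "d = k + 2" using less.prems by auto
    moreover from this have "r = 0 \<or> r = 1 \<or> r = 2" by auto
    ultimately show ?thesis using cut_bound_shift[of r 0 k] by auto
  next
    case 2
    then have r: "r \<le> 3" "d = k + 1" using less.prems by auto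
    have small: "cut_bound 1 r = r * (4 - r) + r"
      using cut_bound_lower_half[of r 0] r by simp
    have vals: "r = 0 \<or> r = 1 \<or> r = 2 \<or> r = 3" using r by auto
    show ?thesis
    proof (cases k)
      case 0
      then show ?thesis using r vals by auto
    next
      case (Suc j)
      then show ?thesis using r small vals cut_bound_shift[of r 1 j] by auto
    qed
  next
    case 3
    then have "e - 2 + 2 = e" by simp
    then have "r \<le> 2 ^ (e - 2 + 2)" "k = e - 2 + d" using 3 less.prems by simp_all
    then show ?thesis using cut_bound_shift[of r "e - 2" d] by simp
  next
    case 4
    define j where "j = e - 2"
    have e: "e = j + 2" and k: "k = Suc j + (d - 1)" using 4 less.prems by (auto simp: j_def)
    define s where "s = r - 2 ^ e"
    have r: "r = 2 ^ e + s" using 4 by (simp add: s_def)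
    have s3: "3 * s \<le> 2 ^ (j + 2) + 2" using less.prems(1) by (simp add: r e power_add)
    have p: "(4::nat) \<le> 2 ^ (j + 2)" by (simp add: power_add)
    have s: "s \<le> 2 ^ (j + 2)" using s3 p by linarith
    \<comment> \<open>The induction hypothesis is taken with slope 2 in dimension \<open>e\<close>.
      Reflection in \<open>2 ^ (e + 1)\<close> turns \<open>r\<close> into \<open>2 ^ e - s\<close>,
      which is \<open>2 * s\<close> less than \<open>r\<close>, and \<open>cut_bound j s\<close>
      makes up this loss. The remaining \<open>d - 1\<close> doublings contribute \<open>r\<close>
      each.\<close>
    have "2 * s \<le> cut_bound j s"
      using s3 4 by (intro less.IH[of j]) (auto simp: e)
    moreover have p3: "2 ^ (j + 3) = (2::nat) * 2 ^ (j + 2)" by (simp add: power_add)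
    moreover have "cut_bound (Suc j) r
        = cut_bound j (2 ^ (j + 2) - s) + (2 ^ (j + 2) - s)"
      using cut_bound_upper_half[of j r] s p3 by (simp add: r e)
    ultimately have "r \<le> cut_bound (Suc j) r"
      using cut_bound_sym[OF s] s by (simp add: r e)
    moreover have "cut_bound k r = cut_bound (Suc j) r + (d - 1) * r"
      using cut_bound_shift[of r "Suc j" "d - 1"] s p3 k by (simp add: r e)
    ultimately show ?thesis using less.prems(3) by (cases d) auto
  qed
qed

text \<open>With \<open>c = k + 2\<close> and \<open>d = Suc j\<close> this covers all sizes from a
  \<open>c\<close>-dimensional subcube up to half of dimension \<open>c + d\<close>. One more
  dimension adds \<open>m\<close>, which is at least \<open>2 ^ c\<close>.\<close>

lemma cut_bound_middle:
  assumes "2 ^ (k + 2) \<le> m" "m \<le> 2 ^ (k + j + 2)"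
  shows "Suc j * 2 ^ (k + 2) \<le> cut_bound (k + Suc j) m"
  using assms
proof (induction j)
  case 0
  then have "m = 2 ^ (k + 2)" by simp
  then show ?case using cut_bound_lower_half[of m k] by simp
next
  case (Suc j)
  have half: "cut_bound (k + Suc (Suc j)) m = cut_bound (k + Suc j) m + m"
    using cut_bound_lower_half[of m "k + Suc j"] Suc.prems by simp
  show ?case
  proof (cases "m \<le> 2 ^ (k + j + 2)")
    case True
    then show ?thesis using Suc half by simp
  next
    case False
    \<comment> \<open>Beyond the range of the induction hypothesis the crude bound
      \<open>r \<le> cut_bound (k + Suc j) r\<close> suffices: \<open>r + m\<close> is the full
      power \<open>2 ^ Suc j * 2 ^ (k + 2)\<close>, and \<open>Suc j < 2 ^ Suc j\<close>.\<close>
    define r where "r = 2 ^ (k + Suc j + 2) - m"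
    have p: "2 ^ (k + Suc j + 2) = (2::nat) * 2 ^ (k + j + 2)" by simp
    have "r \<le> 2 ^ (k + j + 2)" using False p unfolding r_def by linarith
    then have "r \<le> cut_bound (k + Suc j) r"
      using cut_bound_lower_half[of r "k + j"] by simp
    moreover have "cut_bound (k + Suc j) r = cut_bound (k + Suc j) m"
      unfolding r_def using Suc.prems by (intro cut_bound_sym) auto
    moreover have "Suc (Suc j) * 2 ^ (k + 2) \<le> (2::nat) ^ Suc j * 2 ^ (k + 2)"
      by (intro mult_right_mono Suc_leI less_exp) auto
    moreover have "(2::nat) ^ Suc j * 2 ^ (k + 2) = 2 ^ (k + Suc j + 2)"
      by (simp add: power_add)
    moreover have "m + r = 2 ^ (k + Suc j + 2)" using Suc.prems by (simp add: r_def)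
    ultimately show ?thesis using half by linarith
  qed
qed

text \<open>Here \<open>c\<close> is the dimension of the extremal subcube, \<open>d\<close> its
  codimension, and \<open>r\<close> bounds how far \<open>m\<close> may fall short of
  \<open>2 ^ c\<close>. A shortfall \<open>s\<close> gives \<open>d * s\<close> by symmetry and the
  slope bound, the \<open>d\<close> doublings add \<open>d * m\<close>, and
  \<open>s + m = 2 ^ c\<close>.\<close>

lemma cut_bound_ge:
  assumes "c \<ge> 2" "1 \<le> d" "d \<le> c"
    and "m + r \<ge> 2 ^ c" "3 * r \<le> 2 ^ (c - d + 2) + 2" "m \<le> 2 ^ (c + d - 1)"
  shows "d * 2 ^ c \<le> cut_bound (c + d - 2) m"
proof -
  define k where "k = c - 2"
  have c: "c = k + 2" using assms by (simp add: k_def)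
  show ?thesis
  proof (cases "2 ^ c \<le> m")
    case True
    have "c + d - 1 = k + (d - 1) + 2" "c + d - 2 = k + Suc (d - 1)" using assms c by auto
    then show ?thesis using cut_bound_middle[of k m "d - 1"] True assms c by simp
  next
    case False
    define s where "s = 2 ^ c - m"
    have "3 * s \<le> 2 ^ (c - d + 2) + 2" using assms(4,5) by (simp add: s_def)
    then have "d * s \<le> cut_bound k s"
      by (rule cut_bound_ge_slope) (use assms c in auto)
    moreover have "cut_bound k s = cut_bound k m"
      using cut_bound_sym[of m k] False c by (simp add: s_def)
    moreover have "cut_bound (c + d - 2) m = cut_bound k m + d * m"
      using cut_bound_shift[of m k d] False c by simp
    moreover have "d * 2 ^ c = d * s + d * m"
      using False by (simp add: s_def flip: distrib_left)
    ultimately show ?thesis by simp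
  qed
qed

section \<open>Passing between disconnecting edge sets and boundaries of vertex sets\<close>

section \<open>Cuts and components\<close>

text \<open>The record type alone does not force edges to be pairs of vertices, nor the vertex set
  to be finite.\<close>

definition simple_graph :: "'a ugraph \<Rightarrow> bool" where
  "simple_graph G \<longleftrightarrow> finite (verts G) \<and> (\<forall>e \<in> edges G. e \<subseteq> verts G \<and> card e = 2)"

lemma simple_graph_finite_edges: "simple_graph G \<Longrightarrow> finite (edges G)"
  unfolding simple_graph_def by (meson Pow_iff finite_Pow_iff finite_subset subsetI)

lemma finite_edge_cut: "simple_graph G \<Longrightarrow> finite (edge_cut G X)"
  unfolding edge_cut_def by (simp add: simple_graph_finite_edges)

lemma sym_adj_rel: "sym (adj_rel G)"
  unfolding sym_def adj_rel_def by (auto simp: insert_commute)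

lemma adj_rel_induced: "adj_rel (induced_subgraph G X) = {(u, v) \<in> adj_rel G. u \<in> X \<and> v \<in> X}"
  unfolding adj_rel_def induced_subgraph_def by auto

lemma connected_graphI_root:
  assumes "r \<in> verts G" "\<And>v. v \<in> verts G \<Longrightarrow> (v, r) \<in> (adj_rel G)\<^sup>*"
  shows "connected_graph G"
proof -
  have "(r, v) \<in> (adj_rel G)\<^sup>*" if "v \<in> verts G" for v
    using assms(2)[OF that] sym_rtrancl[OF sym_adj_rel] by (rule symD[rotated])
  then show ?thesis
    using assms unfolding connected_graph_def by (blast intro: rtrancl_trans)
qed

lemma induced_subgraph_verts:
  assumes "simple_graph G"
  shows "induced_subgraph G (verts G) = G"
  using assms unfolding simple_graph_def induced_subgraph_def
  by (cases G) auto

lemma edge_cut_verts [simp]: "edge_cut G (verts G) = {}" "edge_cut G {} = {}"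
  by (auto simp: edge_cut_def)

text \<open>Two different components are disjoint, so one of them has at most half of the vertices;
  every edge leaving a component must have been deleted.\<close>

lemma disconnecting_set_contains_cut:
  assumes G: "simple_graph G" "verts G \<noteq> {}"
    and F: "extra_edge_cut h G F"
  obtains X where "X \<subseteq> verts G" "h \<le> card X" "2 * card X \<le> card (verts G)"
    "edge_cut G X \<subseteq> F"
proof -
  define R where "R = (adj_rel (delete_edges G F))\<^sup>*"
  define C where "C u = {v \<in> verts G. (u, v) \<in> R}" for u
  have dv: "verts (delete_edges G F) = verts G" by (simp add: delete_edges_def)
  have symR: "sym R" unfolding R_def by (intro sym_rtrancl sym_adj_rel)
  \<comment> \<open>The null graph is disconnected by definition; with
    \<open>verts G \<noteq> {}\<close> disconnectedness yields a separated pair.\<close>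
  obtain u v where uv: "u \<in> verts G" "v \<in> verts G" "(u, v) \<notin> R"
    using F G(2) unfolding extra_edge_cut_def connected_graph_def dv R_def by blast
  have comp: "h \<le> card (C w)" if "w \<in> verts G" for w
    using F that unfolding extra_edge_cut_def components_def dv C_def R_def by blast
  have cut: "edge_cut G (C w) \<subseteq> F" for w
  proof
    fix e assume "e \<in> edge_cut G (C w)"
    then obtain x y where e: "e \<in> edges G" "x \<in> C w" "y \<in> verts G - C w" "e = {x, y}"
      unfolding edge_cut_def by blast
    show "e \<in> F"
    proof (rule ccontr)
      assume "e \<notin> F"
      then have "(x, y) \<in> adj_rel (delete_edges G F)"
        using e by (simp add: adj_rel_def delete_edges_def)
      then have "(w, y) \<in> R" using e(2) unfolding C_def R_def
        by (auto intro: rtrancl_into_rtrancl)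
      then show False using e(3) by (simp add: C_def)
    qed
  qed
  have fin: "finite (verts G)" using G by (simp add: simple_graph_def)
  have "C u \<inter> C v = {}"
    using uv symR unfolding C_def R_def by (auto dest: symD intro: rtrancl_trans)
  then have "card (C u) + card (C v) = card (C u \<union> C v)"
    using fin by (intro card_Un_disjoint [symmetric]) (auto simp: C_def)
  also have "\<dots> \<le> card (verts G)"
    using fin by (intro card_mono) (auto simp: C_def)
  finally have "2 * card (C u) \<le> card (verts G) \<or> 2 * card (C v) \<le> card (verts G)" by linarith
  moreover have "C w \<subseteq> verts G" for w by (auto simp: C_def)
  ultimately show thesis
    using that[of "C u"] that[of "C v"] comp[OF uv(1)] comp[OF uv(2)] cut by auto
qed

text \<open>Deleting the cut destroys no edge inside either side, so both sides stay connected and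
  each component contains one of them.\<close>

lemma extra_edge_cut_edge_cut:
  assumes G: "simple_graph G"
    and X: "X \<subseteq> verts G" "h \<le> card X" "h \<le> card (verts G - X)"
    and conn: "connected_graph (induced_subgraph G X)"
      "connected_graph (induced_subgraph G (verts G - X))"
  shows "extra_edge_cut h G (edge_cut G X)"
proof -
  define D where "D = delete_edges G (edge_cut G X)"
  have dv: "verts D = verts G" by (simp add: D_def delete_edges_def)
  have fin: "finite (verts G)" using G by (simp add: simple_graph_def)
  have ne: "X \<noteq> {}" "verts G - X \<noteq> {}"
    using conn by (auto simp: connected_graph_def induced_subgraph_def)
  have inside: "(u, v) \<in> (adj_rel D)\<^sup>*"
    if "connected_graph (induced_subgraph G Y)" "u \<in> Y" "v \<in> Y" "Y = X \<or> Y = verts G - X" for u v Y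
  proof -
    have "adj_rel (induced_subgraph G Y) \<subseteq> adj_rel D"
      using that(4) unfolding adj_rel_def induced_subgraph_def D_def delete_edges_def edge_cut_def
      by (auto simp: doubleton_eq_iff)
    moreover have "(u, v) \<in> (adj_rel (induced_subgraph G Y))\<^sup>*"
      using that unfolding connected_graph_def induced_subgraph_def by auto
    ultimately show ?thesis using rtrancl_mono by blast
  qed
  have closed: "v \<in> X" if "(u, v) \<in> (adj_rel D)\<^sup>*" "u \<in> X" for u v
    using that
  proof (induction rule: rtrancl_induct)
    case (step y z)
    then have yz: "{y, z} \<in> edges G" "{y, z} \<notin> edge_cut G X" "y \<in> X"
      by (auto simp: adj_rel_def D_def delete_edges_def)
    then have "z \<in> verts G" using G by (auto simp: simple_graph_def)
    then show ?case using yz unfolding edge_cut_def by blast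
  qed
  have "\<not> connected_graph D"
    using ne X(1) closed unfolding connected_graph_def dv by blast
  moreover have "h \<le> card C" if C: "C \<in> components D" for C
  proof -
    obtain u where u: "u \<in> verts G" "C = {v \<in> verts G. (u, v) \<in> (adj_rel D)\<^sup>*}"
      using C unfolding components_def dv by blast
    then have "X \<subseteq> C \<or> verts G - X \<subseteq> C"
      using inside[OF conn(1)] inside[OF conn(2)] X(1) by blast
    moreover have "finite C" using u fin by simp
    ultimately show ?thesis using X by (meson card_mono le_trans)
  qed
  ultimately show ?thesis
    unfolding extra_edge_cut_def D_def by (auto simp: edge_cut_def)
qed

section \<open>Matchings as bijections, and the edges leaving a set in a join\<close>

section \<open>Cuts in K4-hypercubes\<close>

text \<open>Gives the matching as a function, so that vertex counts can be carried from one half to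
  the other; disjointness tells the two ends of an edge apart.\<close>

lemma perfect_matching_between_bij:
  assumes M: "perfect_matching_between A B M" and disj: "A \<inter> B = {}"
  obtains f where "bij_betw f A B" "M = (\<lambda>a. {a, f a}) ` A"
proof -
  have sub: "\<exists>a\<in>A. \<exists>b\<in>B. e = {a, b}" if "e \<in> M" for e
    using M that unfolding perfect_matching_between_def by blast
  have ex: "\<exists>e. e \<in> M \<and> v \<in> e" if "v \<in> A \<union> B" for v
    using M that unfolding perfect_matching_between_def by blast
  have uniq: "e = e'" if "v \<in> A \<union> B" "e \<in> M" "v \<in> e" "e' \<in> M" "v \<in> e'" for v e e'
    using M that unfolding perfect_matching_between_def by blast
  have "\<exists>b. b \<in> B \<and> {a, b} \<in> M" if "a \<in> A" for a
    using ex[of a] sub that disj by (metis IntI UnI1 empty_iff insert_iff singletonD)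
  then obtain f where f: "\<And>a. a \<in> A \<Longrightarrow> f a \<in> B \<and> {a, f a} \<in> M" by metis
  have "bij_betw f A B"
  proof (rule bij_betwI')
    fix x y assume xy: "x \<in> A" "y \<in> A"
    show "f x = f y \<longleftrightarrow> x = y"
    proof
      assume eq: "f x = f y"
      have "{x, f x} = {y, f y}"
        by (rule uniq[of "f x"]) (use f[OF xy(1)] f[OF xy(2)] eq in auto)
      then show "x = y" using eq by (auto simp: doubleton_eq_iff)
    qed simp
  next
    fix y assume y: "y \<in> B"
    then obtain e where e: "e \<in> M" "y \<in> e" using ex by blast
    then obtain a b where ab: "a \<in> A" "b \<in> B" "e = {a, b}" using sub by blast
    have "y = b" using e ab y disj by auto
    moreover have "{a, f a} = e" using uniq[of a "{a, f a}" e] f ab e by auto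
    ultimately have "y = f a" using ab disj y by (auto simp: doubleton_eq_iff)
    then show "\<exists>x\<in>A. y = f x" using ab by blast
  qed (use f in auto)
  moreover have "M = (\<lambda>a. {a, f a}) ` A"
  proof
    show "M \<subseteq> (\<lambda>a. {a, f a}) ` A"
    proof
      fix e assume e: "e \<in> M"
      then obtain a b where ab: "a \<in> A" "b \<in> B" "e = {a, b}" using sub by blast
      then have "e = {a, f a}" using uniq[of a e "{a, f a}"] f e by auto
      then show "e \<in> (\<lambda>a. {a, f a}) ` A" using ab by blast
    qed
  qed (use f in auto)
  ultimately show thesis using that by blast
qed

text \<open>Old edges stay within one half and matching edges cross, so the three contributions are
  disjoint. A matching edge leaves \<open>X\<close> exactly when one of its ends lies in
  \<open>X\<close>.\<close>

lemma edge_cut_join: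
  assumes G0: "simple_graph G0" and G1: "simple_graph G1"
    and disj: "verts G0 \<inter> verts G1 = {}"
    and f: "bij_betw f (verts G0) (verts G1)"
    and X: "X \<subseteq> verts G0 \<union> verts G1"
    and G: "G = \<lparr>verts = verts G0 \<union> verts G1,
      edges = edges G0 \<union> edges G1 \<union> (\<lambda>a. {a, f a}) ` verts G0\<rparr>"
  shows "card (edge_cut G X) = card (edge_cut G0 (X \<inter> verts G0)) + card (edge_cut G1 (X \<inter> verts G1))
    + card {a \<in> verts G0. (a \<in> X) \<noteq> (f a \<in> X)}"
proof -
  define S where "S = {a \<in> verts G0. (a \<in> X) \<noteq> (f a \<in> X)}"
  have e0: "\<And>e. e \<in> edges G0 \<Longrightarrow> e \<subseteq> verts G0 \<and> e \<noteq> {}"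
    and e1: "\<And>e. e \<in> edges G1 \<Longrightarrow> e \<subseteq> verts G1 \<and> e \<noteq> {}"
    using G0 G1 unfolding simple_graph_def by fastforce+
  have fa: "\<And>a. a \<in> verts G0 \<Longrightarrow> f a \<in> verts G1" using f by (auto simp: bij_betw_def)
  have cut: "e \<in> edge_cut G X \<longleftrightarrow> e \<in> edges G \<and> (\<exists>u v. e = {u, v} \<and> u \<in> X \<and> v \<in> verts G \<and> v \<notin> X)" for e
    by (auto simp: edge_cut_def)
  have "edge_cut G X = edge_cut G0 (X \<inter> verts G0) \<union> edge_cut G1 (X \<inter> verts G1) \<union> (\<lambda>a. {a, f a}) ` S"
    (is "_ = ?R")
  proof
    show "edge_cut G X \<subseteq> ?R"
    proof
      fix e assume "e \<in> edge_cut G X"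
      then obtain u v where uv: "e = {u, v}" "u \<in> X" "v \<notin> X" "e \<in> edges G"
        by (auto simp: cut)
      consider "e \<in> edges G0" | "e \<in> edges G1" | a where "a \<in> verts G0" "e = {a, f a}"
        using uv(4) by (auto simp: G)
      then show "e \<in> ?R"
      proof cases
        case 1
        then show ?thesis using uv e0[of e] by (auto simp: edge_cut_def)
      next
        case 2
        then show ?thesis using uv e1[of e] by (auto simp: edge_cut_def)
      next
        case 3
        then show ?thesis using uv by (auto simp: S_def doubleton_eq_iff)
      qed
    qed
    show "?R \<subseteq> edge_cut G X"
    proof
      fix e assume "e \<in> ?R"
      then consider "e \<in> edge_cut G0 (X \<inter> verts G0)" | "e \<in> edge_cut G1 (X \<inter> verts G1)"
        | a where "a \<in> S" "e = {a, f a}" by blast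
      then show "e \<in> edge_cut G X"
      proof cases
        case 1
        then show ?thesis by (auto simp: edge_cut_def G)
      next
        case 2
        then show ?thesis by (auto simp: edge_cut_def G)
      next
        case 3
        then have "a \<in> verts G0" "f a \<in> verts G1" "(a \<in> X) \<noteq> (f a \<in> X)"
          using fa by (auto simp: S_def)
        then show ?thesis unfolding cut using 3 by (auto simp: G insert_commute)
      qed
    qed
  qed
  moreover have "card ((\<lambda>a. {a, f a}) ` S) = card S"
  proof (rule card_image, rule inj_onI)
    fix x y assume "x \<in> S" "y \<in> S" "{x, f x} = {y, f y}"
    then show "x = y" using fa disj unfolding S_def by (auto simp: doubleton_eq_iff)
  qed
  moreover have "edge_cut G0 (X \<inter> verts G0) \<inter> edge_cut G1 (X \<inter> verts G1) = {}"
    using e0 e1 disj unfolding edge_cut_def by blast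
  moreover have "(edge_cut G0 (X \<inter> verts G0) \<union> edge_cut G1 (X \<inter> verts G1)) \<inter> (\<lambda>a. {a, f a}) ` S = {}"
  proof -
    have "{a, f a} \<notin> edges G0 \<union> edges G1" if "a \<in> S" for a
      using e0[of "{a, f a}"] e1[of "{a, f a}"] fa[of a] that disj unfolding S_def by auto
    moreover have "edge_cut G0 (X \<inter> verts G0) \<subseteq> edges G0" "edge_cut G1 (X \<inter> verts G1) \<subseteq> edges G1"
      by (auto simp: edge_cut_def)
    ultimately show ?thesis by auto
  qed
  moreover have "finite S" using G0 by (simp add: S_def simple_graph_def)
  ultimately show ?thesis
    unfolding S_def[symmetric] using finite_edge_cut[OF G0] finite_edge_cut[OF G1]
    by (simp add: card_Un_disjoint)
qed

text \<open>Pulling \<open>X \<inter> B\<close> back along \<open>f\<close> to \<open>Y\<close>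
  makes the mismatch set the symmetric difference of \<open>X \<inter> A\<close> and
  \<open>Y\<close>.\<close>

lemma card_mismatch_ge:
  assumes f: "bij_betw f A B" and fin: "finite A"
  shows "(card (X \<inter> A) - card (X \<inter> B)) + (card (X \<inter> B) - card (X \<inter> A))
    \<le> card {a \<in> A. (a \<in> X) \<noteq> (f a \<in> X)}"
proof -
  define Y where "Y = {a \<in> A. f a \<in> X}"
  have "bij_betw f Y (X \<inter> B)"
    using f unfolding Y_def bij_betw_def inj_on_def by blast
  then have Y: "card Y = card (X \<inter> B)" by (rule bij_betw_same_card)
  have S: "{a \<in> A. (a \<in> X) \<noteq> (f a \<in> X)} = (X \<inter> A - Y) \<union> (Y - X \<inter> A)"
    by (auto simp: Y_def)
  have fY: "finite Y" using fin by (simp add: Y_def)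
  have "card (X \<inter> A) - card Y \<le> card (X \<inter> A - Y)" "card Y - card (X \<inter> A) \<le> card (Y - X \<inter> A)"
    using fin fY by (simp_all add: diff_card_le_card_Diff)
  moreover have "card (X \<inter> A - Y) \<le> card ((X \<inter> A - Y) \<union> (Y - X \<inter> A))"
    "card (Y - X \<inter> A) \<le> card ((X \<inter> A - Y) \<union> (Y - X \<inter> A))"
    using fin fY by (auto intro!: card_mono)
  ultimately show ?thesis unfolding S Y by linarith
qed

section \<open>Order and connectedness of the family\<close>

lemma K4_hypercube_basic:
  assumes "K4_hypercube n G"
  shows "simple_graph G \<and> card (verts G) = 2 ^ n \<and> n \<ge> 2"
  using assms
proof induction
  case (K4 V)
  then have "finite V" by (intro card_ge_0_finite) simp
  then show ?case using K4 by (simp add: simple_graph_def complete_graph_def)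
next
  case (join n G0 G1 M)
  have "card e = 2 \<and> e \<subseteq> verts G0 \<union> verts G1" if e: "e \<in> M" for e
  proof -
    obtain a b where "a \<in> verts G0" "b \<in> verts G1" "e = {a, b}"
      using join.hyps(5)[unfolded perfect_matching_between_def, THEN conjunct1] e by blast
    moreover from this have "a \<noteq> b" using join.hyps(4) by blast
    ultimately show ?thesis by simp
  qed
  moreover have "(2::nat) ^ n = 2 ^ (n - 1) + 2 ^ (n - 1)"
    using join by (cases n) auto
  ultimately show ?case using join.IH join.hyps(1,4)
    by (auto simp: simple_graph_def card_Un_disjoint)
qed

text \<open>The half \<open>G1\<close> survives intact, and each vertex of \<open>G0\<close> outside
  \<open>X\<close> is attached to it by its matching edge. The instance \<open>X = {}\<close> gives
  connectedness of the whole join.\<close>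

lemma connected_join_complement:
  assumes G1: "connected_graph G1" "simple_graph G1"
    and disj: "verts G0 \<inter> verts G1 = {}"
    and f: "bij_betw f (verts G0) (verts G1)"
    and X: "X \<subseteq> verts G0"
    and G: "G = \<lparr>verts = verts G0 \<union> verts G1,
      edges = edges G0 \<union> edges G1 \<union> (\<lambda>a. {a, f a}) ` verts G0\<rparr>"
  shows "connected_graph (induced_subgraph G (verts G - X))"
proof -
  define R where "R = adj_rel (induced_subgraph G (verts G - X))"
  have v: "verts (induced_subgraph G (verts G - X)) = (verts G0 - X) \<union> verts G1"
    using X disj by (auto simp: induced_subgraph_def G)
  obtain r where r: "r \<in> verts G1" using G1 by (auto simp: connected_graph_def)
  have "adj_rel G1 \<subseteq> R"
    using G1(2) X disj unfolding R_def adj_rel_induced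
    by (fastforce simp: adj_rel_def G simple_graph_def)
  then have R1: "(u, r) \<in> R\<^sup>*" if "u \<in> verts G1" for u
    using G1 r that rtrancl_mono unfolding connected_graph_def by blast
  have fa: "\<And>a. a \<in> verts G0 \<Longrightarrow> f a \<in> verts G1" using f by (auto simp: bij_betw_def)
  have "(u, f u) \<in> R" if "u \<in> verts G0 - X" for u
    using that fa[of u] disj X unfolding R_def adj_rel_induced by (auto simp: adj_rel_def G)
  then have "(u, r) \<in> R\<^sup>*" if "u \<in> (verts G0 - X) \<union> verts G1" for u
    using that R1 fa by (meson DiffD1 UnE converse_rtrancl_into_rtrancl)
  then show ?thesis
    using r unfolding R_def by (intro connected_graphI_root[of r]) (auto simp: v)
qed

lemma K4_hypercube_connected:
  assumes "K4_hypercube n G"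
  shows "connected_graph G"
  using assms
proof induction
  case (K4 V)
  then have "V \<noteq> {}" by auto
  moreover have "(u, v) \<in> (adj_rel (complete_graph V))\<^sup>*" if "u \<in> V" "v \<in> V" for u v
    using that by (cases "u = v") (auto simp: adj_rel_def complete_graph_def)
  ultimately show ?case by (simp add: connected_graph_def complete_graph_def)
next
  case (join n G0 G1 M)
  obtain f where f: "bij_betw f (verts G0) (verts G1)" "M = (\<lambda>a. {a, f a}) ` verts G0"
    using perfect_matching_between_bij[OF join.hyps(5,4)] by blast
  let ?G = "\<lparr>verts = verts G0 \<union> verts G1, edges = edges G0 \<union> edges G1 \<union> M\<rparr>"
  have "K4_hypercube n ?G" using join.hyps by (rule K4_hypercube.join)
  then have "induced_subgraph ?G (verts ?G) = ?G"
    by (intro induced_subgraph_verts) (simp add: K4_hypercube_basic)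
  moreover have "connected_graph (induced_subgraph ?G (verts ?G - {}))"
    using join f K4_hypercube_basic by (intro connected_join_complement[where f = f]) auto
  ultimately show ?case by simp
qed

section \<open>The isoperimetric bound and the sets attaining it\<close>

lemma complete_graph_cut:
  assumes "finite V" "X \<subseteq> V"
  shows "card X * (card V - card X) \<le> card (edge_cut (complete_graph V) X)"
proof -
  have "inj_on (\<lambda>(u, v). {u, v}) (X \<times> (V - X))"
    by (auto simp: inj_on_def doubleton_eq_iff)
  then have "card X * card (V - X) = card ((\<lambda>(u, v). {u, v}) ` (X \<times> (V - X)))"
    by (simp add: card_image card_cartesian_product)
  also have "\<dots> \<le> card (edge_cut (complete_graph V) X)"
  proof (rule card_mono)
    have "edge_cut (complete_graph V) X \<subseteq> Pow V" by (auto simp: edge_cut_def complete_graph_def)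
    then show "finite (edge_cut (complete_graph V) X)"
      using assms finite_subset by blast
    show "(\<lambda>(u, v). {u, v}) ` (X \<times> (V - X)) \<subseteq> edge_cut (complete_graph V) X"
      using assms by (auto simp: edge_cut_def complete_graph_def card_2_iff)
  qed
  finally show ?thesis
    using assms by (simp add: card_Diff_subset finite_subset)
qed

text \<open>Only the sizes of \<open>X\<close> in the two halves enter the induction, so the bound
  holds whatever the matchings and even if the halves are not isomorphic.\<close>

lemma K4_hypercube_cut_bound:
  assumes "K4_hypercube n G" "X \<subseteq> verts G"
  shows "cut_bound (n - 2) (card X) \<le> card (edge_cut G X)"
  using assms
proof (induction arbitrary: X)
  case (K4 V)
  moreover from this have "finite V" by (intro card_ge_0_finite) simp
  ultimately show ?case using complete_graph_cut[of V X] by (simp add: complete_graph_def)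
next
  case (join n G0 G1 M)
  obtain f where f: "bij_betw f (verts G0) (verts G1)" "M = (\<lambda>a. {a, f a}) ` verts G0"
    using perfect_matching_between_bij[OF join.hyps(5,4)] by blast
  define k where "k = n - 3"
  have k: "n - 2 = Suc k" "n - 1 - 2 = k" "n - 1 = k + 2" using join.hyps(1) by (auto simp: k_def)
  have b: "simple_graph G0" "simple_graph G1" "card (verts G0) = 2 ^ (k + 2)" "card (verts G1) = 2 ^ (k + 2)"
    using K4_hypercube_basic[OF join.hyps(2)] K4_hypercube_basic[OF join.hyps(3)] k by auto
  have fin: "finite (verts G0)" "finite (verts G1)" using b by (auto simp: simple_graph_def)
  let ?X0 = "X \<inter> verts G0" and ?X1 = "X \<inter> verts G1"
  have "card X = card (?X0 \<union> ?X1)" using join.prems by (intro arg_cong[where f = card]) auto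
  also have "\<dots> = card ?X0 + card ?X1"
    using fin join.hyps(4) by (intro card_Un_disjoint) auto
  finally have "cut_bound (n - 2) (card X) = cut_bound (Suc k) (card ?X0 + card ?X1)" using k by simp
  also have "\<dots> \<le> cut_bound k (card ?X0) + cut_bound k (card ?X1)
      + (card ?X0 - card ?X1) + (card ?X1 - card ?X0)"
    using fin b by (intro cut_bound_join) (metis card_mono inf_le2)+
  also have "\<dots> \<le> card (edge_cut G0 ?X0) + card (edge_cut G1 ?X1)
      + card {a \<in> verts G0. (a \<in> X) \<noteq> (f a \<in> X)}"
    using join.IH(1)[of ?X0] join.IH(2)[of ?X1] card_mismatch_ge[OF f(1) fin(1), of X] k(2)
    by simp
  also have "\<dots> = card (edge_cut \<lparr>verts = verts G0 \<union> verts G1, edges = edges G0 \<union> edges G1 \<union> M\<rparr> X)"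
    using join.prems f b join.hyps(4)
    by (intro edge_cut_join[symmetric]) auto
  finally show ?case .
qed

text \<open>The witness is found by descending into the first half until dimension \<open>c\<close>
  is reached. For \<open>c = n\<close> it is the whole vertex set, whose complement is null and
  hence not connected; this explains the guard \<open>c < n\<close>.\<close>

lemma K4_hypercube_subcube:
  assumes "K4_hypercube n G" "2 \<le> c" "c \<le> n"
  shows "\<exists>X \<subseteq> verts G. card X = 2 ^ c \<and> connected_graph (induced_subgraph G X) \<and>
    (c < n \<longrightarrow> connected_graph (induced_subgraph G (verts G - X))) \<and>
    card (edge_cut G X) = (n - c) * 2 ^ c"
  using assms
proof (induction)
  case (K4 V)
  let ?G = "complete_graph V"
  have "K4_hypercube 2 ?G" using K4 by (intro K4_hypercube.K4)
  then show ?case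
    using K4 K4_hypercube_basic[of 2 ?G] K4_hypercube_connected[of 2 ?G]
    by (intro exI[of _ "verts ?G"]) (auto simp: induced_subgraph_verts)
next
  case (join n G0 G1 M)
  let ?G = "\<lparr>verts = verts G0 \<union> verts G1, edges = edges G0 \<union> edges G1 \<union> M\<rparr>"
  have HG: "K4_hypercube n ?G" using join.hyps by (rule K4_hypercube.join)
  show ?case
  proof (cases "c = n")
    case True
    then show ?thesis
      using K4_hypercube_basic[OF HG] K4_hypercube_connected[OF HG] edge_cut_verts(1)[of ?G]
        induced_subgraph_verts[of ?G]
      by (intro exI[of _ "verts ?G"]) (simp del: edge_cut_verts)
  next
    case False
    then have cn: "c \<le> n - 1" using join.prems by simp
    then obtain X where X: "X \<subseteq> verts G0" "card X = 2 ^ c"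
      "connected_graph (induced_subgraph G0 X)" "card (edge_cut G0 X) = (n - 1 - c) * 2 ^ c"
      using join.IH(1) join.prems by blast
    obtain f where f: "bij_betw f (verts G0) (verts G1)" "M = (\<lambda>a. {a, f a}) ` verts G0"
      using perfect_matching_between_bij[OF join.hyps(5,4)] by blast
    have b: "simple_graph G0" "simple_graph G1" "connected_graph G1"
      using K4_hypercube_basic join.hyps K4_hypercube_connected by blast+
    have fa: "\<And>a. a \<in> verts G0 \<Longrightarrow> f a \<in> verts G1" using f by (auto simp: bij_betw_def)
    have "adj_rel (induced_subgraph G0 X) \<subseteq> adj_rel (induced_subgraph ?G X)"
      by (auto simp: adj_rel_def induced_subgraph_def)
    then have "(adj_rel (induced_subgraph G0 X))\<^sup>* \<subseteq> (adj_rel (induced_subgraph ?G X))\<^sup>*"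
      by (rule rtrancl_mono)
    moreover have "verts (induced_subgraph G' X) = X" for G' :: "'a ugraph"
      by (simp add: induced_subgraph_def)
    ultimately have "connected_graph (induced_subgraph ?G X)"
      using X(3) unfolding connected_graph_def by (simp add: subset_iff)
    moreover have "connected_graph (induced_subgraph ?G (verts ?G - X))"
      using b f join.hyps(4) X(1) by (intro connected_join_complement[where f = f]) auto
    moreover have "card (edge_cut ?G X) = card (edge_cut G0 (X \<inter> verts G0))
        + card (edge_cut G1 (X \<inter> verts G1)) + card {a \<in> verts G0. (a \<in> X) \<noteq> (f a \<in> X)}"
      using b f join.hyps(4) X(1) by (intro edge_cut_join) auto
    \<comment> \<open>\<open>X\<close> lies in one half, so all matching edges at \<open>X\<close>
      leave it: each join adds exactly \<open>card X\<close> edges to the cut.\<close>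
    moreover have "X \<inter> verts G0 = X" "X \<inter> verts G1 = {}"
      "{a \<in> verts G0. (a \<in> X) \<noteq> (f a \<in> X)} = X"
      using X(1) join.hyps(4) fa by auto
    moreover have "(n - c) * 2 ^ c = (n - 1 - c) * 2 ^ c + (2::nat) ^ c"
    proof -
      have "n - c = Suc (n - 1 - c)" using cn join.hyps(1) by simp
      then show ?thesis by simp
    qed
    ultimately show ?thesis using X by (intro exI[of _ X]) auto
  qed
qed

section \<open>Both invariants from the lower bound and the extremal subcube\<close>

lemma K4_hypercube_extra_edge_connectivity:
  assumes H: "K4_hypercube n H" and cd: "n = c + d" "2 \<le> c" "1 \<le> d" "d \<le> c"
    and h: "3 * (2 ^ c - h) \<le> 2 ^ (c - d + 2) + 2" "h \<le> 2 ^ c"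
  shows "extra_edge_connectivity h H = enat (d * 2 ^ c)" "xi (2 ^ c) H = enat (d * 2 ^ c)"
proof -
  have b: "simple_graph H" "card (verts H) = 2 ^ n"
    using K4_hypercube_basic[OF H] by auto
  have n: "2 ^ n = (2::nat) * 2 ^ (n - 1)"
    using cd(1,3) power_Suc[of "2::nat" "n - 1"] by simp
  have "(2::nat) ^ c \<le> 2 ^ (n - 1)" using cd by (intro power_increasing) auto
  have lower: "d * 2 ^ c \<le> card (edge_cut H X)"
    if "X \<subseteq> verts H" "h \<le> card X" "card X \<le> 2 ^ (n - 1)" for X
  proof -
    have "d * 2 ^ c \<le> cut_bound (c + d - 2) (card X)"
      \<comment> \<open>The permitted shortfall from \<open>2 ^ c\<close> is
        \<open>2 ^ c - h\<close>, since \<open>card X\<close> is at least \<open>h\<close>.\<close>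
      using that cd h by (intro cut_bound_ge[where r = "2 ^ c - h"]) auto
    also have "\<dots> \<le> card (edge_cut H X)"
      using K4_hypercube_cut_bound[OF H that(1)] cd by simp
    finally show ?thesis .
  qed
  obtain X where X: "X \<subseteq> verts H" "card X = 2 ^ c" "connected_graph (induced_subgraph H X)"
    "connected_graph (induced_subgraph H (verts H - X))" "card (edge_cut H X) = d * 2 ^ c"
    using K4_hypercube_subcube[OF H, of c] cd by auto
  have "finite X" using X(2) by (intro card_ge_0_finite) simp
  then have "card (verts H - X) = 2 ^ n - 2 ^ c"
    using X b by (simp add: card_Diff_subset)
  \<comment> \<open>The complement holds at least half of the vertices, and
    \<open>h \<le> 2 ^ c \<le> 2 ^ (n - 1)\<close>.\<close>
  then have "h \<le> card (verts H - X)" using h(2) n \<open>2 ^ c \<le> 2 ^ (n - 1)\<close> by linarith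
  then have F: "extra_edge_cut h H (edge_cut H X)"
    using X b h by (intro extra_edge_cut_edge_cut) auto
  show "xi (2 ^ c) H = enat (d * 2 ^ c)"
    unfolding xi_def
  proof (rule antisym)
    show "(INF Y \<in> {Y. Y \<subseteq> verts H \<and> card Y = 2 ^ c \<and> connected_graph (induced_subgraph H Y) \<and>
        connected_graph (induced_subgraph H (verts H - Y))}. enat (card (edge_cut H Y)))
        \<le> enat (d * 2 ^ c)"
      by (rule INF_lower2[of X]) (use X in auto)
  \<comment> \<open>Sets of size \<open>2 ^ c\<close> fall under \<open>lower\<close> because
    \<open>h \<le> 2 ^ c\<close>.\<close>
  qed (use lower h \<open>2 ^ c \<le> 2 ^ (n - 1)\<close> in \<open>auto intro!: INF_greatest\<close>)
  show "extra_edge_connectivity h H = enat (d * 2 ^ c)"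
    unfolding extra_edge_connectivity_def
  proof (rule antisym)
    show "(INF F \<in> {F. extra_edge_cut h H F}. enat (card F)) \<le> enat (d * 2 ^ c)"
      by (rule INF_lower2[of "edge_cut H X"]) (use X F in auto)
    show "enat (d * 2 ^ c) \<le> (INF F \<in> {F. extra_edge_cut h H F}. enat (card F))"
    proof (rule INF_greatest)
      fix F assume "F \<in> {F. extra_edge_cut h H F}"
      then have F: "extra_edge_cut h H F" by simp
      have "verts H \<noteq> {}" using b by auto
      from disconnecting_set_contains_cut[OF b(1) this F]
      obtain Y where Y: "Y \<subseteq> verts H" "h \<le> card Y" "2 * card Y \<le> card (verts H)" "edge_cut H Y \<subseteq> F" .
      have "d * 2 ^ c \<le> card (edge_cut H Y)" using Y b n by (intro lower) auto
      also have "\<dots> \<le> card F"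
        using Y(4) F simple_graph_finite_edges[OF b(1)] unfolding extra_edge_cut_def
        by (intro card_mono) (auto intro: finite_subset)
      finally show "enat (d * 2 ^ c) \<le> enat (card F)" by simp
    qed
  qed
qed

theorem theorem2:
  fixes n \<gamma> t h :: nat and H :: "'a ugraph"
  assumes "n \<ge> 4"
    and "\<gamma> = (if even n then 0 else 1)"
    and "K4_hypercube n H"
    and "t \<in> {0..n div 2 - 1}"
    and "2 ^ (nat \<lceil>real n / 2\<rceil> + t) - \<lceil>2 ^ (2 * t + 2 + \<gamma>) / (3::real)\<rceil> \<le> int h"
    and "h \<le> 2 ^ (nat \<lceil>real n / 2\<rceil> + t)"
  shows "extra_edge_connectivity h H = xi (2 ^ (nat \<lceil>real n / 2\<rceil> + t)) H
    \<and> xi (2 ^ (nat \<lceil>real n / 2\<rceil> + t)) H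
        = enat ((n div 2 - t) * 2 ^ (nat \<lceil>real n / 2\<rceil> + t))"
proof -
  define c where "c = nat \<lceil>real n / 2\<rceil> + t"
  define d where "d = n div 2 - t"
  have "nat \<lceil>real n / 2\<rceil> = n div 2 + \<gamma>"
    using assms(2) by (cases "even n") (auto elim!: evenE oddE simp: ceiling_eq_iff intro!: nat_eq_iff[THEN iffD2])
  then have c: "c = n div 2 + \<gamma> + t" by (simp add: c_def)
  \<comment> \<open>This gives \<open>c + d = n\<close> and \<open>c - d = 2 * t + \<gamma>\<close>,
    which matches the exponent in the ceiling with that of the slope bound.\<close>
  have "n = 2 * (n div 2) + \<gamma>" using assms(2) by presburger
  then have cd: "n = c + d" "2 \<le> c" "1 \<le> d" "d \<le> c" "c - d + 2 = 2 * t + 2 + \<gamma>"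
    using assms(1,4) c d_def by auto
  define r where "r = 2 ^ c - h"
  have r: "int r = 2 ^ c - int h" using assms(6) by (simp add: r_def c_def of_nat_diff)
  have "int r \<le> \<lceil>2 ^ (c - d + 2) / (3::real)\<rceil>"
    using assms(5) cd(5) r by (simp add: c_def)
  \<comment> \<open>An integer is at most a ceiling iff it exceeds the number by less than 1. After
    multiplying by 3 the strict bound with \<open>+ 3\<close> becomes, over the naturals, the weak
    bound with \<open>+ 2\<close>.\<close>
  then have "real r - 1 < 2 ^ (c - d + 2) / 3"
    by (simp add: le_ceiling_iff)
  then have "real (3 * r) < real (2 ^ (c - d + 2) + 3)" by simp
  then have "3 * r < 2 ^ (c - d + 2) + 3" by (simp only: of_nat_less_iff)
  then have "3 * (2 ^ c - h) \<le> 2 ^ (c - d + 2) + 2" by (simp add: r_def)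
  from K4_hypercube_extra_edge_connectivity[OF assms(3) cd(1-4) this]
  show ?thesis using assms(6) by (simp add: c_def d_def)
qed

end
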